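(* Let $\vec{A}=(A_1,\dots,A_n)$ be a ballot profile over a candidate set $C$, let $1\le k\le |C|$, let $W\subseteq C$ be a committee with $|W|=k$, and let $\mathbf{x}$ be the payoff vector associated with $W$ in the game $\mathcal{G}(\vec{A},k)$, i.e. $x_i=u_i(W)$ for all $i\in N$. (1) $W$ provides justified representation for $(\vec{A},k)$ if and only if no coalition of size $\lceil\frac nk\rceil$ or less has a profitable deviation from $\mathbf{x}$. (2) $W$ provides extended justified representation for $(\vec{A},k)$ if and only if for every integer $\ell\ge 0$ no coalition $N^*\subseteq N$ with $\ell\cdot\frac nk\le|N^*|<(\ell+1)\cdot\frac nk$ and $|\bigcap_{i\in N^*}A_i|\ge\ell$ has a profitable deviation from $\mathbf{x}$.
   Context: Setting. $N=\{1,\dots,n\}$ ($n\ge 1$) is a set of voters, $C$ is a finite set of candidates. Each voter $i\in N$ submits an approval ballot $A_i\subseteq C$; the list $\vec{A}=(A_1,\dots,A_n)$ is the ballot profile. Justified representation (JR). A set $W\subseteq C$ with $|W|=k$ provides JR for $(\vec{A},k)$ if there is no set $N^*\subseteq N$ with $|N^*|\ge \frac{n}{k}$ such that $\bigcap_{i\in N^*}A_i\neq\emptyset$ and $A_i\cap W=\emptyset$ for all $i\in N^*$. Extended justified representation (EJR). For a positive integer $\ell\le k$, $W$ with $|W|=k$ provides $\ell$-JR for $(\vec{A},k)$ if there is no set $N^*\subseteq N$ with $|N^*|\ge\ell\cdot\frac nk$ such that $|\bigcap_{i\in N^*}A_i|\ge\ell$ but $|A_i\cap W|<\ell$ for each $i\in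 N^*$. $W$ provides EJR for $(\vec{A},k)$ if it provides $\ell$-JR for all $\ell$ with $1\le\ell\le k$. The NTU game $\mathcal{G}(\vec{A},k)$. The set of players is $N$. For a committee $S'\subseteq C$ let $u_i(S')=1+\frac12+\dots+\frac{1}{|A_i\cap S'|}$ (equal to $0$ if $A_i\cap S'=\emptyset$). For a (nonempty) coalition $S\subseteq N$, let $\ell\in\{0,1,\dots,k\}$ be the integer with $\ell\frac nk\le|S|<(\ell+1)\frac nk$; such a coalition can "purchase" $\ell$ alternatives. A payoff vector $\mathbf{y}\in\mathbb{R}^n$ is feasible for $S$, written $\mathbf{y}\in V(S)$, if and only if there is a committee $S'\subseteq C$ with $|S'|\le\ell$ such that $y_i=u_i(S')$ for each $i\in S$ (so if $\ell=0$ then $y_i=0$ for all $i\in S$). A coalition $S$ has a profitable deviation from a payoff vector $\mathbf{x}\in V(N)$ if there is $\mathbf{y}\in V(S)$ such that $y_i>x_i$ for all $i\in S$.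
   Formalization: For large k the equivalences fail as stated: "JR implies no profitable deviation" in (1) is claimed only for k < 2n, and "no profitable deviation implies EJR" in (2) only for k ≤ n; the two converse implications are claimed for all k. *)

theory Defs
  imports Complex_Main
begin

(* The ballot profile is a function A of which only the values at the voters 1, ..., n matter;
   likewise payoff vectors in R^n are functions of which only the values at 1, ..., n matter. *)

definition voters :: "nat \<Rightarrow> nat set" where
  "voters n = {1..n}"

(* In the next two definitions the size bound forces S to be nonempty when n, k, l >= 1, so the
   convention for the intersection of the empty family plays no role. *)

definition provides_JR :: "nat \<Rightarrow> (nat \<Rightarrow> 'c set) \<Rightarrow> nat \<Rightarrow> 'c set \<Rightarrow> bool" where
  "provides_JR n A k W \<longleftrightarrow>
     \<not> (\<exists>S. S \<subseteq> voters n \<and> real (card S) \<ge> real n / real k \<and>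
            (\<Inter>i\<in>S. A i) \<noteq> {} \<and> (\<forall>i\<in>S. A i \<inter> W = {}))"

definition provides_level_JR ::
    "nat \<Rightarrow> nat \<Rightarrow> (nat \<Rightarrow> 'c set) \<Rightarrow> nat \<Rightarrow> 'c set \<Rightarrow> bool" where
  "provides_level_JR l n A k W \<longleftrightarrow>
     \<not> (\<exists>S. S \<subseteq> voters n \<and> real (card S) \<ge> real l * (real n / real k) \<and>
            card (\<Inter>i\<in>S. A i) \<ge> l \<and> (\<forall>i\<in>S. card (A i \<inter> W) < l))"

definition provides_EJR :: "nat \<Rightarrow> (nat \<Rightarrow> 'c set) \<Rightarrow> nat \<Rightarrow> 'c set \<Rightarrow> bool" where
  "provides_EJR n A k W \<longleftrightarrow> (\<forall>l. 1 \<le> l \<and> l \<le> k \<longrightarrow> provides_level_JR l n A k W)"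

definition utility :: "(nat \<Rightarrow> 'c set) \<Rightarrow> 'c set \<Rightarrow> nat \<Rightarrow> real" where
  "utility A S' i = (\<Sum>j = 1..card (A i \<inter> S'). 1 / real j)"

definition coalition :: "nat \<Rightarrow> nat set \<Rightarrow> bool" where
  "coalition n S \<longleftrightarrow> S \<subseteq> voters n \<and> S \<noteq> {}"

definition purchases :: "nat \<Rightarrow> nat \<Rightarrow> nat set \<Rightarrow> nat \<Rightarrow> bool" where
  "purchases n k S l \<longleftrightarrow>
     real l * (real n / real k) \<le> real (card S) \<and>
     real (card S) < (real l + 1) * (real n / real k)"

(* V(S), for a coalition S. *)
definition feasible_payoffs ::
    "nat \<Rightarrow> 'c set \<Rightarrow> (nat \<Rightarrow> 'c set) \<Rightarrow> nat \<Rightarrow> nat set \<Rightarrow> (nat \<Rightarrow> real) set" where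
  "feasible_payoffs n C A k S =
     {y. \<exists>l S'. l \<le> k \<and> purchases n k S l \<and> S' \<subseteq> C \<and> card S' \<le> l \<and>
          (\<forall>i\<in>S. y i = utility A S' i)}"

definition has_profitable_deviation ::
    "nat \<Rightarrow> 'c set \<Rightarrow> (nat \<Rightarrow> 'c set) \<Rightarrow> nat \<Rightarrow> nat set \<Rightarrow> (nat \<Rightarrow> real) \<Rightarrow> bool" where
  "has_profitable_deviation n C A k S x \<longleftrightarrow>
     (\<exists>y \<in> feasible_payoffs n C A k S. \<forall>i\<in>S. y i > x i)"

(* When k > n a single voter may be entitled to several candidates, and parts of the
   characterizations of JR and EJR by profitable deviations break down:
   - n = 1, k = 2, A 1 = {a, b}, W = {a, c}: JR holds, but voter 1 alone can purchase {a, b} and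
     profits.  That JR excludes deviations by coalitions of size at most the ceiling of n / k
     needs k < 2 * n.
   - n = 1, k = 2, A 1 = {a}, W = {b, c}: EJR fails, but the only coalition purchases two
     candidates while |A 1| < 2.  That the absence of deviations by cohesive coalitions implies
     EJR needs k <= n.
   The two converse implications need no bound on k. *)

end

(* Utilities are harmonic numbers of the number of approved committee members, so a deviation only
   compares these numbers.  Conversely, a coalition blocking JR or EJR at level l is shrunk to
   exactly the ceiling of l * n / k members: this keeps it below the size bound of (1), and, for
   k <= n, keeps it from being able to purchase more than the l candidates required in (2). *)

theory Submission
  imports Defs
begin

section \<open>Profitable deviations as comparisons of cardinalities\<close>

lemma utility_less_iff:
  "utility A W i < utility A S' i \<longleftrightarrow> card (A i \<inter> W) < card (A i \<inter> S')"
proof -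
  have "strict_mono (\<lambda>m. \<Sum>j = 1..m. 1 / real j)"
    by (simp add: strict_mono_Suc_iff)
  then show ?thesis
    unfolding utility_def by (rule strict_mono_less)
qed

text \<open>On \<open>S\<close> a feasible payoff is determined by the purchased committee
  \<open>S'\<close>, so the payoff vector can be eliminated in favour of
  \<open>utility A S'\<close>. From here on only numbers of approved candidates occur.\<close>

lemma has_profitable_deviation_utility_iff:
  assumes "\<forall>i\<in>S. x i = utility A W i"
  shows "has_profitable_deviation n C A k S x \<longleftrightarrow>
    (\<exists>l S'. l \<le> k \<and> purchases n k S l \<and> S' \<subseteq> C \<and> card S' \<le> l \<and>
       (\<forall>i\<in>S. card (A i \<inter> W) < card (A i \<inter> S')))" (is "_ \<longleftrightarrow> ?R")
proof
  assume "has_profitable_deviation n C A k S x"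
  then obtain y l S' where *: "l \<le> k" "purchases n k S l" "S' \<subseteq> C" "card S' \<le> l"
    and y: "\<forall>i\<in>S. y i = utility A S' i" "\<forall>i\<in>S. x i < y i"
    unfolding has_profitable_deviation_def feasible_payoffs_def by blast
  have "\<forall>i\<in>S. card (A i \<inter> W) < card (A i \<inter> S')"
    using y assms by (simp add: utility_less_iff)
  with * show ?R
    by blast
next
  assume ?R
  then obtain l S' where *: "l \<le> k" "purchases n k S l" "S' \<subseteq> C" "card S' \<le> l"
    "\<forall>i\<in>S. card (A i \<inter> W) < card (A i \<inter> S')"
    by blast
  then have "utility A S' \<in> feasible_payoffs n C A k S"
    unfolding feasible_payoffs_def by blast
  moreover have "\<forall>i\<in>S. x i < utility A S' i"
    using * assms by (simp add: utility_less_iff)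
  ultimately show "has_profitable_deviation n C A k S x"
    unfolding has_profitable_deviation_def by blast
qed

section \<open>Coalition sizes and purchasing power\<close>

lemma card_voters_subset_le: "S \<subseteq> voters n \<Longrightarrow> card S \<le> n"
  using card_mono[of "{1..n}" S] by (simp add: voters_def)

lemma finite_voters_subset: "S \<subseteq> voters n \<Longrightarrow> finite S"
  by (auto simp: voters_def intro: finite_subset)

text \<open>The half-open intervals from \<open>l\<close> to \<open>l + 1\<close> quotas are
  disjoint because the quota n / k is positive. This identifies the level hidden in a deviation with
  the one at which cohesion is measured.\<close>

lemma purchases_unique:
  assumes "n \<ge> 1" "k \<ge> 1" "purchases n k S l" "purchases n k S l'"
  shows "l = l'"
proof -
  have q: "real n / real k > 0"
    using assms by simp
  have le: "a \<le> b" if "purchases n k S a" "purchases n k S b" for a b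
  proof -
    have "real a * (real n / real k) < (real b + 1) * (real n / real k)"
      using that unfolding purchases_def by linarith
    then have "real a < real b + 1"
      using q mult_less_cancel_right_pos by blast
    then show ?thesis
      by linarith
  qed
  show ?thesis
    using le assms by (blast intro: antisym)
qed

text \<open>The witness is the floor of \<open>card S\<close> divided by the quota; it is at most
  \<open>k\<close> because all \<open>n\<close> voters together amount to exactly \<open>k\<close>
  quotas.\<close>

lemma purchases_exists:
  assumes "n \<ge> 1" "k \<ge> 1" "S \<subseteq> voters n"
  obtains l where "l \<le> k" "purchases n k S l"
proof
  let ?q = "real n / real k"
  let ?l = "nat \<lfloor>real (card S) / ?q\<rfloor>"
  have q: "?q > 0"
    using assms by simp
  have l: "real ?l \<le> real (card S) / ?q" "real (card S) / ?q < real ?l + 1"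
    by (simp_all add: of_nat_nat)
  then show p: "purchases n k S ?l"
    unfolding purchases_def using q
    by (simp only: pos_le_divide_eq pos_divide_less_eq simp_thms)
  have "real (card S) / ?q \<le> real n / ?q"
    using card_voters_subset_le[OF assms(3)] q by (intro divide_right_mono) simp_all
  also have "\<dots> = real k"
    using assms by simp
  finally show "?l \<le> k"
    using l by linarith
qed

lemma obtain_subset_card_ceiling:
  assumes "finite S" "r \<le> real (card S)"
  obtains T where "T \<subseteq> S" "card T = nat \<lceil>r\<rceil>"
proof -
  have "nat \<lceil>r\<rceil> \<le> card S"
    using assms by (simp add: nat_le_iff ceiling_le_iff)
  then show ?thesis
    using that obtain_subset_with_card_n by metis
qed

text \<open>Applied with \<open>B\<close> the ballot of a member who gains: the purchased set limits
  how many approved candidates that member gets, and a strict gain rules out an empty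
  purchase.\<close>

lemma deviation_size_bounds:
  assumes "finite C" "S' \<subseteq> C" "card S' \<le> l" "m < card (B \<inter> S')"
  shows "card (B \<inter> S') \<le> l" "l \<ge> 1"
proof -
  have "finite S'"
    using assms finite_subset by blast
  then have "card (B \<inter> S') \<le> card S'"
    by (simp add: card_mono)
  then show "card (B \<inter> S') \<le> l" "l \<ge> 1"
    using assms by linarith+
qed

text \<open>With \<open>q\<close> the quota, the hypothesis says k < 2 * n, and the conclusion keeps
  every coalition within the size bound of (1) from purchasing two candidates.\<close>

lemma ceiling_less_twice:
  fixes q :: real
  assumes "1 / 2 < q"
  shows "of_int \<lceil>q\<rceil> < 2 * q"
proof (cases "q \<le> 1")
  case True
  then have "\<lceil>q\<rceil> = 1"
    using assms by (simp add: ceiling_eq_iff)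
  then show ?thesis
    using assms by simp
next
  case False
  then show ?thesis
    using of_int_ceiling_le_add_one[of q] ceiling_correct[of q] by linarith
qed

section \<open>The four implications, for a fixed game and committee\<close>

locale committee_game =
  fixes n k :: nat and C W :: "'c set" and A :: "nat \<Rightarrow> 'c set" and x :: "nat \<Rightarrow> real"
  assumes voter: "n \<ge> 1"
    and fin: "finite C"
    and ballots: "\<forall>i \<in> voters n. A i \<subseteq> C"
    and k: "1 \<le> k"
    and W: "W \<subseteq> C"
    and x: "\<forall>i \<in> voters n. x i = utility A W i"
begin

lemma quota_pos: "real n / real k > 0"
  using voter k by simp

lemma deviation_iff:
  assumes "S \<subseteq> voters n"
  shows "has_profitable_deviation n C A k S x \<longleftrightarrow>
    (\<exists>l S'. l \<le> k \<and> purchases n k S l \<and> S' \<subseteq> C \<and> card S' \<le> l \<and>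
       (\<forall>i\<in>S. card (A i \<inter> W) < card (A i \<inter> S')))"
  using assms x by (intro has_profitable_deviation_utility_iff) blast

lemma Inter_ballots_subset:
  assumes "coalition n S"
  shows "(\<Inter>i\<in>S. A i) \<subseteq> C"
  using assms ballots unfolding coalition_def by blast

text \<open>A deviating coalition of this size purchases exactly one candidate. Each member gains
  only by approving that candidate and nobody in \<open>W\<close>, so the coalition itself violates
  JR.\<close>

lemma JR_imp_no_deviation:
  assumes kn: "k < 2 * n" and JR: "provides_JR n A k W"
    and S: "coalition n S" and small: "int (card S) \<le> \<lceil>real n / real k\<rceil>"
  shows "\<not> has_profitable_deviation n C A k S x"
proof
  let ?q = "real n / real k"
  assume dev: "has_profitable_deviation n C A k S x"
  have SV: "S \<subseteq> voters n" and "S \<noteq> {}"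
    using S by (auto simp: coalition_def)
  obtain l S' where l: "l \<le> k" "purchases n k S l" "S' \<subseteq> C" "card S' \<le> l"
    and less: "\<forall>i\<in>S. card (A i \<inter> W) < card (A i \<inter> S')"
    using dev deviation_iff[OF SV] by blast
  obtain j where j: "j \<in> S"
    using \<open>S \<noteq> {}\<close> by blast
  have "l \<ge> 1"
    using deviation_size_bounds(2)[OF fin l(3,4) less[rule_format, OF j]] .
  have "1 / 2 < ?q"
    using kn k by (simp add: field_simps)
  then have "real (card S) < 2 * ?q"
    using ceiling_less_twice[of ?q] small by linarith
  then have "real l * ?q < 2 * ?q"
    using l(2) by (simp add: purchases_def)
  then have "real l < 2"
    using quota_pos mult_less_cancel_right_pos by blast
  with \<open>l \<ge> 1\<close> have "l = 1"
    by simp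
  have finS': "finite S'"
    using l(3) fin finite_subset by blast
  have cS: "card S' = 1"
  proof -
    have "S' \<noteq> {}"
      using less j by force
    then show ?thesis
      using finS' l(4) \<open>l = 1\<close> by (simp add: le_Suc_eq)
  qed
  then obtain c where c: "S' = {c}"
    using card_1_singletonE by blast
  have each: "c \<in> A i \<and> A i \<inter> W = {}" if "i \<in> S" for i
  proof -
    have 1: "card (A i \<inter> W) < card (A i \<inter> {c})"
      using less that c by simp
    then have cA: "c \<in> A i"
      by (cases "c \<in> A i") auto
    with 1 have "card (A i \<inter> W) = 0"
      by simp
    \<comment> \<open>Infinite sets also have \<open>card\<close> 0, so emptiness needs
      finiteness.\<close>
    moreover have "finite (A i \<inter> W)"
      using W fin finite_subset by blast
    ultimately show ?thesis
      using cA by simp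
  qed
  have "?q \<le> real (card S)"
    using l(2) \<open>l = 1\<close> by (simp add: purchases_def)
  then show False
    using JR each SV unfolding provides_JR_def by blast
qed

text \<open>The shrunk coalition can afford a commonly approved candidate \<open>c\<close>, and
  \<open>{c}\<close> alone improves on \<open>W\<close> for members who have nobody in
  \<open>W\<close>.\<close>

lemma no_deviation_imp_JR:
  assumes stable: "\<And>S. coalition n S \<Longrightarrow> int (card S) \<le> \<lceil>real n / real k\<rceil> \<Longrightarrow>
      \<not> has_profitable_deviation n C A k S x"
  shows "provides_JR n A k W"
  unfolding provides_JR_def
proof
  let ?q = "real n / real k"
  assume "\<exists>S. S \<subseteq> voters n \<and> real (card S) \<ge> ?q \<and>
            (\<Inter>i\<in>S. A i) \<noteq> {} \<and> (\<forall>i\<in>S. A i \<inter> W = {})"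
  then obtain S where S: "S \<subseteq> voters n" "?q \<le> real (card S)" "(\<Inter>i\<in>S. A i) \<noteq> {}"
    "\<forall>i\<in>S. A i \<inter> W = {}"
    by (elim exE conjE)
  obtain c where c: "\<forall>i\<in>S. c \<in> A i"
    using S(3) by auto
  obtain T where T: "T \<subseteq> S" "card T = nat \<lceil>?q\<rceil>"
    using obtain_subset_card_ceiling[OF finite_voters_subset[OF S(1)] S(2)] .
  have TV: "T \<subseteq> voters n"
    using T S by blast
  have pos: "\<lceil>?q\<rceil> > 0"
    using quota_pos by simp
  then have "T \<noteq> {}"
    using T(2) by auto
  then have co: "coalition n T"
    using TV by (simp add: coalition_def)
  obtain l where l: "l \<le> k" "purchases n k T l"
    using purchases_exists[OF voter k TV] .
  have "?q \<le> real (card T)"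
    using T(2) pos by (simp add: of_nat_nat)
  \<comment> \<open>The coalition reaches one full quota, which excludes \<open>l = 0\<close>; a
    larger \<open>l\<close> is harmless since \<open>{c}\<close> need not use it up.\<close>
  then have "?q * 1 < ?q * (real l + 1)"
    using l(2) unfolding purchases_def by (simp only: mult.commute mult_1_right) linarith
  then have "l \<ge> 1"
    using quota_pos by (cases l) simp_all
  then have "card {c} \<le> l"
    by simp
  moreover have "{c} \<subseteq> C"
    using Inter_ballots_subset[OF co] T(1) c \<open>T \<noteq> {}\<close> by blast
  moreover have "\<forall>i\<in>T. card (A i \<inter> W) < card (A i \<inter> {c})"
    using T(1) c S(4) by auto
  ultimately have "has_profitable_deviation n C A k T x"
    using deviation_iff[OF TV] l by blast
  then show False
    using stable[OF co] T(2) pos by simp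
qed

text \<open>A member who gains has fewer approved candidates in \<open>W\<close> than in
  \<open>S'\<close>, hence fewer than \<open>l\<close>, so a cohesive deviating coalition violates
  EJR at its own level.\<close>

lemma EJR_imp_no_deviation:
  assumes EJR: "provides_EJR n A k W" and S: "coalition n S" and p: "purchases n k S l"
    and coh: "card (\<Inter>i\<in>S. A i) \<ge> l"
  shows "\<not> has_profitable_deviation n C A k S x"
proof
  assume dev: "has_profitable_deviation n C A k S x"
  have SV: "S \<subseteq> voters n" and "S \<noteq> {}"
    using S by (auto simp: coalition_def)
  obtain l' S' where l': "l' \<le> k" "purchases n k S l'" "S' \<subseteq> C" "card S' \<le> l'"
    and less: "\<forall>i\<in>S. card (A i \<inter> W) < card (A i \<inter> S')"
    using dev deviation_iff[OF SV] by blast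
  have [simp]: "l' = l"
    using purchases_unique[OF voter k l'(2) p] .
  have bounds: "card (A i \<inter> S') \<le> l \<and> l \<ge> 1" if "i \<in> S" for i
    using deviation_size_bounds[OF fin l'(3,4) less[rule_format, OF that]] by simp
  \<comment> \<open>EJR speaks only about levels from 1 to \<open>k\<close>: the lower bound comes
    from the gain of some member of \<open>S\<close>, the upper one from feasibility.\<close>
  then have "1 \<le> l" "l \<le> k"
    using \<open>S \<noteq> {}\<close> l'(1) by auto
  then have "provides_level_JR l n A k W"
    using EJR unfolding provides_EJR_def by blast
  moreover have "\<forall>i\<in>S. card (A i \<inter> W) < l"
    using bounds less by (meson less_le_trans)
  ultimately show False
    using SV p coh unfolding provides_level_JR_def purchases_def by blast
qed

text \<open>The shrunk coalition inherits cohesion, and any \<open>l\<close> commonly approved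
  candidates give each member \<open>l\<close> approvals, against fewer than \<open>l\<close> in
  \<open>W\<close>.\<close>

lemma no_deviation_imp_EJR:
  assumes kn: "k \<le> n"
    and stable: "\<And>l S. coalition n S \<Longrightarrow> purchases n k S l \<Longrightarrow> card (\<Inter>i\<in>S. A i) \<ge> l \<Longrightarrow>
      \<not> has_profitable_deviation n C A k S x"
  shows "provides_EJR n A k W"
  unfolding provides_EJR_def provides_level_JR_def
proof (intro allI impI notI)
  fix l
  let ?q = "real n / real k"
  assume l: "1 \<le> l \<and> l \<le> k"
  assume "\<exists>S. S \<subseteq> voters n \<and> real (card S) \<ge> real l * ?q \<and>
            card (\<Inter>i\<in>S. A i) \<ge> l \<and> (\<forall>i\<in>S. card (A i \<inter> W) < l)"
  then obtain S where S: "S \<subseteq> voters n" "real l * ?q \<le> real (card S)"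
    "l \<le> card (\<Inter>i\<in>S. A i)" "\<forall>i\<in>S. card (A i \<inter> W) < l"
    by blast
  obtain T where T: "T \<subseteq> S" "card T = nat \<lceil>real l * ?q\<rceil>"
    using obtain_subset_card_ceiling[OF finite_voters_subset[OF S(1)] S(2)] .
  have TV: "T \<subseteq> voters n"
    using T S by blast
  have lq: "real l * ?q > 0"
    using quota_pos l by (simp add: mult_pos_pos del: times_divide_eq_right)
  then have cT: "real (card T) = of_int \<lceil>real l * ?q\<rceil>"
    using T(2) by (simp add: of_nat_nat del: times_divide_eq_right)
  \<comment> \<open>Rounding up adds less than 1, hence less than one quota, so \<open>T\<close>
    stays below \<open>l + 1\<close> quotas.\<close>
  have "?q \<ge> 1"
    using kn k by simp
  then have p: "purchases n k T l"
    using ceiling_correct[of "real l * ?q"] unfolding purchases_def cT distrib_right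
    by linarith
  have "real (card T) > 0"
    using cT lq le_of_int_ceiling[of "real l * ?q"] by linarith
  then have "T \<noteq> {}"
    by auto
  then have co: "coalition n T"
    using TV by (simp add: coalition_def)
  obtain S' where S': "S' \<subseteq> (\<Inter>i\<in>S. A i)" "card S' = l"
    using obtain_subset_with_card_n[OF S(3)] by blast
  have sub: "S' \<subseteq> (\<Inter>i\<in>T. A i)"
    using S'(1) T(1) by blast
  then have SC: "S' \<subseteq> C"
    using Inter_ballots_subset[OF co] by blast
  \<comment> \<open>Passing to fewer voters enlarges the intersection; since \<open>T\<close> is
    nonempty it still lies in the finite set \<open>C\<close>, so \<open>card\<close> is monotone
    here.\<close>
  have "l \<le> card (\<Inter>i\<in>T. A i)"
    using card_mono[OF finite_subset[OF Inter_ballots_subset[OF co] fin] sub] S'(2) by simp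
  then have "\<not> has_profitable_deviation n C A k T x"
    using stable[OF co p] by blast
  moreover have "\<forall>i\<in>T. card (A i \<inter> W) < card (A i \<inter> S')"
  proof
    fix i assume "i \<in> T"
    then have "A i \<inter> S' = S'"
      using sub by blast
    then show "card (A i \<inter> W) < card (A i \<inter> S')"
      using S(4) S'(2) T(1) \<open>i \<in> T\<close> by auto
  qed
  ultimately show False
    using deviation_iff[OF TV] l p SC S'(2) by blast
qed

end

theorem theorem12:
  fixes n k :: nat and C W :: "'c set" and A :: "nat \<Rightarrow> 'c set" and x :: "nat \<Rightarrow> real"
  assumes "n \<ge> 1"
    and "finite C"
    and "\<forall>i \<in> voters n. A i \<subseteq> C"
    and "1 \<le> k" and "k \<le> card C"
    and "W \<subseteq> C" and "card W = k"
    and "\<forall>i \<in> voters n. x i = utility A W i"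
  shows "(k < 2 * n \<longrightarrow>
            (provides_JR n A k W \<longleftrightarrow>
              (\<forall>S. coalition n S \<and> int (card S) \<le> \<lceil>real n / real k\<rceil> \<longrightarrow>
                 \<not> has_profitable_deviation n C A k S x))) \<and>
         (k \<le> n \<longrightarrow>
            (provides_EJR n A k W \<longleftrightarrow>
              (\<forall>l S. coalition n S \<and> real l * (real n / real k) \<le> real (card S) \<and>
                 real (card S) < (real l + 1) * (real n / real k) \<and> card (\<Inter>i\<in>S. A i) \<ge> l \<longrightarrow>
                 \<not> has_profitable_deviation n C A k S x))) \<and>
         ((\<forall>S. coalition n S \<and> int (card S) \<le> \<lceil>real n / real k\<rceil> \<longrightarrow>
             \<not> has_profitable_deviation n C A k S x) \<longrightarrow>
          provides_JR n A k W) \<and>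
         (provides_EJR n A k W \<longrightarrow>
          (\<forall>l S. coalition n S \<and> real l * (real n / real k) \<le> real (card S) \<and>
             real (card S) < (real l + 1) * (real n / real k) \<and> card (\<Inter>i\<in>S. A i) \<ge> l \<longrightarrow>
             \<not> has_profitable_deviation n C A k S x))"
proof -
  interpret committee_game n k C W A x
    using assms by unfold_locales
  let ?stable = "\<lambda>S. \<not> has_profitable_deviation n C A k S x"
  let ?small = "\<forall>S. coalition n S \<and> int (card S) \<le> \<lceil>real n / real k\<rceil> \<longrightarrow> ?stable S"
  let ?cohesive = "\<forall>l S. coalition n S \<and> real l * (real n / real k) \<le> real (card S) \<and>
    real (card S) < (real l + 1) * (real n / real k) \<and> card (\<Inter>i\<in>S. A i) \<ge> l \<longrightarrow> ?stable S"
  have JR_imp: "?small" if "k < 2 * n" "provides_JR n A k W"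
    using JR_imp_no_deviation[OF that] by blast
  have imp_JR: "provides_JR n A k W" if "?small"
    using that by (intro no_deviation_imp_JR) blast
  have EJR_imp: "?cohesive" if "provides_EJR n A k W"
    using EJR_imp_no_deviation[OF that] unfolding purchases_def by blast
  have imp_EJR: "provides_EJR n A k W" if "k \<le> n" "?cohesive"
    using that(2) by (intro no_deviation_imp_EJR[OF that(1)]) (simp only: purchases_def, blast)
  show ?thesis
    \<comment> \<open>Splitting leaves six goals, each closed by one of the four
      implications.\<close>
    by (intro conjI impI iffI; (erule (1) JR_imp | erule imp_JR | erule EJR_imp | erule (1) imp_EJR))
qed

end
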